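(* Let $A\in\mathbb{F}^{n\times n}$ be nonsingular with at most $m$ nonzero entries per row, let $B\in\mathbb{F}^{n\times s}$ with $\|B\|=1$, and let $X_0=O$, $R_0=B$. Let $\hat Y_k\in\mathbb{F}^{n\times s}$ and $\hat S_k\in\mathbb{F}^{n\times s}$ ($k\ge1$) be the $k$th approximation and smoothed residual, respectively, generated by the cross-interactive residual smoothing (CIRS) algorithm (described in the context) in finite precision arithmetic. Then the norm of the residual gap $G_{\hat S_k}:=(B-A\hat Y_k)-\hat S_k$ is bounded, up to terms of order $O(\mathbf{u}^2)$, by $$\|G_{\hat S_k}\|\le k(5+2m)\,\mathbf{u}\,\|A\|\max_{0<j\le k}\|\hat Y_j\|+5(k+1)\,\mathbf{u}\max_{0\le j\le k}\|\hat S_j\|.$$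
   Context: $\mathbb{F}\subset\mathbb{R}$ is the set of floating point numbers, $\mathrm{fl}(\cdot)$ denotes the result of a floating point computation, $\mathbf{u}$ is the unit roundoff, $\langle X,Y\rangle_F=\mathrm{tr}(X^\top Y)$, $\|\cdot\|$ is the Frobenius norm, and $m$ is the maximum number of nonzero entries per row of $A$. Here $s\ll n$. CIRS algorithm. Given $X_0$ and $R_0=B-AX_0$, set $\hat Y_0:=X_0$, $\hat S_0:=R_0$, $\hat V_0:=O$, $\hat\eta_0:=0$. For $k=0,1,2,\dots$: (1) compute a direction matrix $\hat P_k$ (corresponding to $X_{k+1}-X_k$) by the primary iterative method for $AX=B$; if the primary method updates $X_{k+1}=X_k+\alpha_kP_k$ with a scalar $\alpha_k$, or $X_{k+1}=X_k+P_k\alpha_k^\square$ with an $s\times s$ matrix $\alpha_k^\square$, then $\hat P_k$ is $\alpha_kP_k$ or $P_k\alpha_k^\square$, respectively; (2) $\hat V_{k+1}=(1-\hat\eta_k)\hat V_k+\hat P_k$; (3) $\hat U_{k+1}=A\hat V_{k+1}$, computed by an explicit multiplication by $A$; (4) $\hat\eta_{k+1}=\langle\hat S_k,\hat U_{k+1}\rangle_F/\langle\hat U_{k+1},\hat U_{k+1}\rangle_F$; (5) $\hat Y_{k+1}=\hat Y_k+\hat\eta_{k+1}\hat V_{k+1}$, $\hat S_{k+1}=\hat S_k-\hat\eta_{k+1}\hat U_{k+1}$; (6) $X_{k+1}=\hat Y_{k+1}+(1-\hat\eta_{k+1})\hat V_{k+1}$, $R_{k+1}=\hat S_{k+1}-(1-\hat\eta_{k+1})\hat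 U_{k+1}$, which are returned to the primary method. It is understood that the algorithm does not break down. Rounding model, for $P,Q\in\mathbb{F}^{n\times s}$ and $\alpha\in\mathbb{F}$: $\mathrm{fl}(P+Q)=P+Q+E'$ with $\|E'\|\le\mathbf{u}(\|P\|+\|Q\|)$; $\mathrm{fl}(\alpha P)=\alpha P+E''$ with $\|E''\|\le\mathbf{u}\|\alpha P\|$; $\mathrm{fl}(AP)=AP+E'''$ with $\|E'''\|\le m\mathbf{u}\|A\|\|P\|$. Subtraction is treated like addition. Convention: terms of $O(\mathbf{u}^2)$ are omitted, and $\mathbf{u}\|\mathrm{fl}(\ast)\|$ is regarded as $\mathbf{u}\|\ast\|$. In finite precision arithmetic all quantities denote computed values; in particular $\hat U_{k+1}=\mathrm{fl}(A\hat V_{k+1})$, $\hat Y_{k+1}=\mathrm{fl}(\hat Y_k+\mathrm{fl}(\hat\eta_{k+1}\hat V_{k+1}))$ and $\hat S_{k+1}=\mathrm{fl}(\hat S_k-\mathrm{fl}(\hat\eta_{k+1}\hat U_{k+1}))$. In the definition of $G_{\hat S_k}$ the expression $(B-A\hat Y_k)-\hat S_k$ is evaluated exactly. *)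

theory Defs
  imports "HOL-Analysis.Analysis"
begin

text \<open>
  A real matrix with rows indexed by \<open>'n\<close> and columns indexed by \<open>'s\<close> has type \<open>real^'s^'n\<close>.
  On this type the library inner product and norm are the Frobenius ones:
\<close>

lemma inner_eq_trace:
  fixes P Q :: "real^'s^'n"
  shows "P \<bullet> Q = trace (transpose P ** Q)"
  unfolding trace_def matrix_matrix_mult_def transpose_def inner_vec_def
  by (simp add: sum.swap[of _ "UNIV :: 'n set"])

lemma norm_eq_sqrt_trace:
  fixes P :: "real^'s^'n"
  shows "norm P = sqrt (trace (transpose P ** P))"
  by (simp add: norm_eq_sqrt_inner inner_eq_trace)

text \<open>
  A floating point arithmetic: the set of floating point numbers, the unit roundoff, and the
  computed versions \<open>fl(P + Q)\<close>, \<open>fl(P - Q)\<close>, \<open>fl(\<alpha> P)\<close>, \<open>fl(A P)\<close> of the matrix operations and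
  \<open>fl(\<alpha> - \<beta>)\<close>, \<open>fl(\<alpha> / \<beta>)\<close>, \<open>fl(\<langle>P, Q\<rangle>)\<close> of the scalar-valued ones.
\<close>

record ('n, 's) fp_arith =
  fp_set :: "real set"
  fp_u :: real
  fp_add :: "real^'s^'n \<Rightarrow> real^'s^'n \<Rightarrow> real^'s^'n"
  fp_sub :: "real^'s^'n \<Rightarrow> real^'s^'n \<Rightarrow> real^'s^'n"
  fp_scale :: "real \<Rightarrow> real^'s^'n \<Rightarrow> real^'s^'n"
  fp_mult :: "real^'n^'n \<Rightarrow> real^'s^'n \<Rightarrow> real^'s^'n"
  fp_minus :: "real \<Rightarrow> real \<Rightarrow> real"
  fp_divide :: "real \<Rightarrow> real \<Rightarrow> real"
  fp_inner :: "real^'s^'n \<Rightarrow> real^'s^'n \<Rightarrow> real"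

definition matrices_over :: "real set \<Rightarrow> (real^'s^'n) set" where
  "matrices_over F = {P. \<forall>i j. P $ i $ j \<in> F}"

definition max_row_nonzeros_le :: "real^'s^'n \<Rightarrow> nat \<Rightarrow> bool" where
  "max_row_nonzeros_le A m \<longleftrightarrow> (\<forall>i. card {j. A $ i $ j \<noteq> 0} \<le> m)"

text \<open>
  The rounding model for a coefficient matrix \<open>A\<close> with at most \<open>m\<close> nonzero entries per row.
  Its bounds are understood up to terms of order \<open>u\<^sup>2\<close>, relative to the size of the operands;
  \<open>K\<close> is the constant in these terms, and \<open>K = 0\<close> gives the first-order bounds themselves.
  Nothing is assumed about the accuracy of the scalar-valued operations.
\<close>

definition rounding_model ::
  "('n::finite, 's::finite) fp_arith \<Rightarrow> real^'n^'n \<Rightarrow> nat \<Rightarrow> real \<Rightarrow> bool" where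
  "rounding_model fp A m K \<longleftrightarrow>
    (let F = fp_set fp; u = fp_u fp; M = (matrices_over F :: (real^'s^'n) set) in
      0 \<in> F \<and> 1 \<in> F \<and>
      (\<forall>P\<in>M. \<forall>Q\<in>M.
         fp_add fp P Q \<in> M \<and>
         norm (fp_add fp P Q - (P + Q)) \<le> (u + K * u^2) * (norm P + norm Q)) \<and>
      (\<forall>P\<in>M. \<forall>Q\<in>M.
         fp_sub fp P Q \<in> M \<and>
         norm (fp_sub fp P Q - (P - Q)) \<le> (u + K * u^2) * (norm P + norm Q)) \<and>
      (\<forall>\<alpha>\<in>F. \<forall>P\<in>M.
         fp_scale fp \<alpha> P \<in> M \<and>
         norm (fp_scale fp \<alpha> P - \<alpha> *\<^sub>R P) \<le> (u + K * u^2) * norm (\<alpha> *\<^sub>R P)) \<and>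
      (\<forall>P\<in>M.
         fp_mult fp A P \<in> M \<and>
         norm (fp_mult fp A P - A ** P) \<le> (real m * u + K * u^2) * norm A * norm P) \<and>
      (\<forall>\<alpha>\<in>F. \<forall>\<beta>\<in>F. fp_minus fp \<alpha> \<beta> \<in> F) \<and>
      (\<forall>\<alpha>\<in>F. \<forall>\<beta>\<in>F. \<beta> \<noteq> 0 \<longrightarrow> fp_divide fp \<alpha> \<beta> \<in> F) \<and>
      (\<forall>P\<in>M. \<forall>Q\<in>M. fp_inner fp P Q \<in> F))"

text \<open>
  The first \<open>N\<close> iterations of CIRS in the arithmetic \<open>fp\<close>, without breakdown, started from
  \<open>X 0\<close> and \<open>R 0\<close>. All sequences consist of computed quantities.
  The primary method is an arbitrary map \<open>primary\<close> that turns the pairs \<open>(X 0, R 0), \<dots>, (X k, R k)\<close>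
  it has received so far into the direction matrix \<open>P k\<close>; its internal recurrences, and whether
  \<open>P k\<close> arose as \<open>\<alpha>\<^sub>k P\<^sub>k\<close> with a scalar or as a product with an \<open>s \<times> s\<close> matrix, are part of that map.
\<close>

definition cirs_run ::
  "('n::finite, 's::finite) fp_arith \<Rightarrow> real^'n^'n \<Rightarrow>
   (((real^'s^'n) \<times> (real^'s^'n)) list \<Rightarrow> real^'s^'n) \<Rightarrow> nat \<Rightarrow>
   (nat \<Rightarrow> real^'s^'n) \<Rightarrow> (nat \<Rightarrow> real^'s^'n) \<Rightarrow> (nat \<Rightarrow> real^'s^'n) \<Rightarrow> (nat \<Rightarrow> real^'s^'n) \<Rightarrow>
   (nat \<Rightarrow> real^'s^'n) \<Rightarrow> (nat \<Rightarrow> real^'s^'n) \<Rightarrow> (nat \<Rightarrow> real^'s^'n) \<Rightarrow> (nat \<Rightarrow> real) \<Rightarrow> bool" where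
  "cirs_run fp A primary N X R P V U Y S \<eta> \<longleftrightarrow>
    Y 0 = X 0 \<and> S 0 = R 0 \<and> V 0 = 0 \<and> \<eta> 0 = 0 \<and>
    (\<forall>k<N.
      P k = primary (map (\<lambda>j. (X j, R j)) [0..<Suc k]) \<and>
      P k \<in> matrices_over (fp_set fp) \<and>
      V (Suc k) = fp_add fp (fp_scale fp (fp_minus fp 1 (\<eta> k)) (V k)) (P k) \<and>
      U (Suc k) = fp_mult fp A (V (Suc k)) \<and>
      fp_inner fp (U (Suc k)) (U (Suc k)) \<noteq> 0 \<and>
      \<eta> (Suc k) = fp_divide fp (fp_inner fp (S k) (U (Suc k)))
                              (fp_inner fp (U (Suc k)) (U (Suc k))) \<and>
      Y (Suc k) = fp_add fp (Y k) (fp_scale fp (\<eta> (Suc k)) (V (Suc k))) \<and>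
      S (Suc k) = fp_sub fp (S k) (fp_scale fp (\<eta> (Suc k)) (U (Suc k))) \<and>
      X (Suc k) = fp_add fp (Y (Suc k))
                    (fp_scale fp (fp_minus fp 1 (\<eta> (Suc k))) (V (Suc k))) \<and>
      R (Suc k) = fp_sub fp (S (Suc k))
                    (fp_scale fp (fp_minus fp 1 (\<eta> (Suc k))) (U (Suc k))))"

definition residual_gap ::
  "real^'n^'n \<Rightarrow> real^'s^'n \<Rightarrow> real^'s^'n \<Rightarrow> real^'s^'n \<Rightarrow> real^'s^'n" where
  "residual_gap A B Y S = (B - A ** Y) - S"

end

theory Submission imports Defs begin

text \<open>
  Writing \<open>D = \<eta> V\<close> for the exact update of one step, the exact recurrences leave the residual gap
  unchanged, so it grows by at most the local rounding errors. Besides the norms of the iterates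
  these involve \<open>\<parallel>D\<parallel>\<close> and \<open>\<parallel>\<eta> U\<parallel>\<close>; but \<open>D\<close> and \<open>\<eta> U\<close> are, up to sign and \<open>O(u)\<close>, differences
  of consecutive iterates, so their norms are controlled too, whatever the size of \<open>\<eta>\<close>.
\<close>

text \<open>Cauchy-Schwarz for each entry, row of \<open>A\<close> against column of
  \<open>P\<close>; the double sum of these bounds factorises.\<close>

lemma norm_matrix_mult_le:
  fixes A :: "real^'m^'n" and P :: "real^'s^'m"
  shows "norm (A ** P) \<le> norm A * norm P"
proof -
  have sq: "(norm M)\<^sup>2 = (\<Sum>i\<in>UNIV. \<Sum>j\<in>UNIV. (M $ i $ j)\<^sup>2)" for M :: "real^'a^'b"
    by (simp add: norm_vec_def L2_set_def sum_nonneg)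
  have entry: "((A ** P) $ i $ j)\<^sup>2 \<le> (\<Sum>l\<in>UNIV. (A $ i $ l)\<^sup>2) * (\<Sum>l\<in>UNIV. (P $ l $ j)\<^sup>2)" for i j
    unfolding matrix_matrix_mult_def by (simp add: Cauchy_Schwarz_ineq_sum)
  have "(norm (A ** P))\<^sup>2 \<le>
      (\<Sum>i\<in>UNIV. \<Sum>j\<in>UNIV. (\<Sum>l\<in>UNIV. (A $ i $ l)\<^sup>2) * (\<Sum>l\<in>UNIV. (P $ l $ j)\<^sup>2))"
    unfolding sq by (intro sum_mono entry)
  also have "\<dots> = (norm A)\<^sup>2 * (\<Sum>j\<in>UNIV. \<Sum>l\<in>UNIV. (P $ l $ j)\<^sup>2)"
    by (simp add: sq sum_product)
  also have "\<dots> = (norm A * norm P)\<^sup>2"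
    by (subst sum.swap) (simp add: sq power_mult_distrib)
  finally show ?thesis
    by (rule power2_le_imp_le) simp
qed

text \<open>Here \<open>d\<close> is the exact update, \<open>w\<close> its rounded value and
  \<open>y'\<close> the rounded sum. The distance from \<open>d\<close> to \<open>y' - y\<close> is
  bounded by a multiple of \<open>norm y\<close> plus a small multiple of \<open>norm d\<close>;
  absorbing the latter on the left bounds \<open>d\<close> by the iterates alone.\<close>

lemma norm_exact_update_le:
  fixes y y' w d :: "'a::real_normed_vector"
  assumes v: "0 \<le> v" "v \<le> 1/8"
    and w: "norm (w - d) \<le> v * norm d"
    and y': "norm (y' - (y + w)) \<le> v * (norm y + norm w)"
  shows "norm d \<le> (1 + 8 * v) * (norm y + norm y')"
    and "norm (y' - y - d) \<le> v * norm y + (2 * v + v\<^sup>2) * norm d"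
proof -
  have "norm w \<le> norm d + v * norm d"
    using norm_triangle_ineq[of d "w - d"] w by simp
  then have "v * norm w \<le> v * (norm d + v * norm d)"
    using v(1) by (rule mult_left_mono)
  moreover have "norm (y' - y - d) \<le> norm (y' - (y + w)) + norm (w - d)"
    using norm_triangle_ineq[of "y' - (y + w)" "w - d"] by (simp add: algebra_simps)
  ultimately show err: "norm (y' - y - d) \<le> v * norm y + (2 * v + v\<^sup>2) * norm d"
    using w y' by (simp add: algebra_simps power2_eq_square)
  have "norm d \<le> norm (y' - y) + norm (y' - y - d)"
    using norm_triangle_ineq4[of "y' - y" "y' - y - d"] by simp
  also have "norm (y' - y) \<le> norm y' + norm y"
    by (rule norm_triangle_ineq4)
  \<comment> \<open>The extra \<open>v * norm y'\<close> makes the right-hand side symmetric in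
    \<open>y\<close> and \<open>y'\<close>.\<close>
  finally have "norm d \<le> norm y' + norm y + (v * norm y + (2 * v + v\<^sup>2) * norm d) + v * norm y'"
    using err mult_nonneg_nonneg[OF v(1) norm_ge_zero[of y']] by linarith
  then have le: "(1 - 2 * v - v\<^sup>2) * norm d \<le> (1 + v) * (norm y + norm y')"
    by (simp add: algebra_simps)
  have "v * v \<le> v * (1/8)"
    using v by (intro mult_left_mono) auto
  then have v2: "v\<^sup>2 \<le> v / 8"
    by (simp add: power2_eq_square)
  have "v * v\<^sup>2 \<le> (1/8) * (v / 8)"
    using v v2 by (intro mult_mono) auto
  \<comment> \<open>Division-free form of the bound \<open>1 + 8 * v\<close> for the quotient of
    \<open>1 + v\<close> by \<open>1 - 2 * v - v\<^sup>2\<close>.\<close>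
  then have "1 + v \<le> (1 + 8 * v) * (1 - 2 * v - v\<^sup>2)"
    using v v2 by (simp add: algebra_simps power2_eq_square)
  then have "(1 + v) * (norm y + norm y')
      \<le> (1 + 8 * v) * (1 - 2 * v - v\<^sup>2) * (norm y + norm y')"
    by (rule mult_right_mono) simp
  with le have "(1 - 2 * v - v\<^sup>2) * norm d
      \<le> (1 - 2 * v - v\<^sup>2) * ((1 + 8 * v) * (norm y + norm y'))"
    by (simp add: mult_ac)
  moreover have "0 < 1 - 2 * v - v\<^sup>2"
    using v v2 by linarith
  ultimately show "norm d \<le> (1 + 8 * v) * (norm y + norm y')"
    by (simp only: mult_le_cancel_left_pos)
qed

text \<open>To first order \<open>norm d\<close> is at most \<open>2 * a\<close>. The error is then
  \<open>u * a\<close> from the operand \<open>y\<close> plus \<open>2 * u * norm d\<close> from the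
  two roundings that affect the update, which makes \<open>5 * u * a\<close>.\<close>

lemma rounded_update_le:
  fixes y y' w d :: "'a::real_normed_vector"
  assumes K: "0 \<le> K" and u: "0 < u" "u \<le> 1 / (16 * (K + 1))"
    and w: "norm (w - d) \<le> (u + K * u\<^sup>2) * norm d"
    and y': "norm (y' - (y + w)) \<le> (u + K * u\<^sup>2) * (norm y + norm w)"
    and a: "norm y \<le> a" "norm y' \<le> a"
  shows "norm d \<le> (2 + 32 * u) * a"
    and "norm (y' - y - d) \<le> (5 * u + (5 * K + 144) * u\<^sup>2) * a"
proof -
  define v where "v = u + K * u\<^sup>2"
  \<comment> \<open>The restriction on \<open>u\<close> keeps both \<open>u\<close> and
    \<open>K * u\<close> small, so the effective roundoff \<open>v\<close> is at most
    \<open>2 * u\<close>, hence at most \<open>1/8\<close>.\<close>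
  have "u * (16 * (K + 1)) \<le> 1"
    using u K by (simp add: pos_le_divide_eq)
  then have uK: "16 * u + 16 * (K * u) \<le> 1"
    by (simp add: algebra_simps)
  have "0 \<le> K * u"
    using K u by simp
  have u16: "u \<le> 1/16" and Ku: "K * u \<le> 1"
    using uK u \<open>0 \<le> K * u\<close> by linarith+
  have "(K * u) * u \<le> 1 * u"
    using Ku u by (intro mult_right_mono) auto
  then have v: "0 \<le> v" "v \<le> 2 * u"
    using K u by (auto simp: v_def power2_eq_square mult.assoc)
  then have v8: "v \<le> 1/8"
    using u16 by linarith
  have a0: "0 \<le> a"
    using a(1) norm_ge_zero[of y] by linarith
  have d: "norm d \<le> (1 + 8 * v) * (norm y + norm y')"
    and e: "norm (y' - y - d) \<le> v * norm y + (2 * v + v\<^sup>2) * norm d"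
    using norm_exact_update_le[OF v(1) v8 w[folded v_def] y'[folded v_def]] by blast+
  have "(1 + 8 * v) * (norm y + norm y') \<le> (1 + 8 * v) * (2 * a)"
    using v a by (intro mult_left_mono) auto
  then have d2: "norm d \<le> (1 + 8 * v) * (2 * a)"
    using d by linarith
  also have "\<dots> \<le> (1 + 16 * u) * (2 * a)"
    using v a0 by (intro mult_right_mono) auto
  finally show "norm d \<le> (2 + 32 * u) * a"
    by (simp add: algebra_simps)
  have v2: "v\<^sup>2 \<le> 4 * u\<^sup>2"
    using power_mono[OF v(2,1), of 2] by (simp add: power_mult_distrib)
  have "v * v\<^sup>2 \<le> 1/8 * v\<^sup>2"
    using v8 by (intro mult_right_mono) auto
  \<comment> \<open>Expanding gives \<open>34 * v\<^sup>2\<close> plus a cubic term of at most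
    \<open>2 * v\<^sup>2\<close>. Below, \<open>v \<le> 2 * u\<close> turns 36 into 144.\<close>
  then have "v + (2 * v + v\<^sup>2) * (2 * (1 + 8 * v)) \<le> 5 * v + 36 * v\<^sup>2"
    by (simp add: algebra_simps power2_eq_square)
  also have "\<dots> \<le> 5 * u + (5 * K + 144) * u\<^sup>2"
    using v2 by (simp add: v_def algebra_simps)
  finally have c: "v + (2 * v + v\<^sup>2) * (2 * (1 + 8 * v)) \<le> 5 * u + (5 * K + 144) * u\<^sup>2" .
  have "v * norm y + (2 * v + v\<^sup>2) * norm d \<le> v * a + (2 * v + v\<^sup>2) * ((1 + 8 * v) * (2 * a))"
    using v a d2 by (intro add_mono mult_left_mono) auto
  also have "\<dots> = (v + (2 * v + v\<^sup>2) * (2 * (1 + 8 * v))) * a"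
    by (simp add: algebra_simps)
  also have "\<dots> \<le> (5 * u + (5 * K + 144) * u\<^sup>2) * a"
    using c a0 by (rule mult_right_mono)
  finally show "norm (y' - y - d) \<le> (5 * u + (5 * K + 144) * u\<^sup>2) * a"
    using e by linarith
qed

text \<open>Three local errors remain: the product by \<open>A\<close>, scaled by
  \<open>\<eta>\<close>, contributes \<open>2 * m\<close> because \<open>\<eta> *\<^sub>R V\<close>
  has norm about \<open>2 * a\<close> at most; the updates of \<open>y\<close> and \<open>s\<close>
  contribute 5 each.\<close>

lemma residual_gap_step:
  fixes A :: "real^'n^'n" and B y y' s s' V U W T :: "real^'s^'n" and m :: nat
  assumes K: "0 \<le> K" and u: "0 < u" "u \<le> 1 / (16 * (K + 1))"
    and U: "norm (U - A ** V) \<le> (real m * u + K * u\<^sup>2) * norm A * norm V"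
    and W: "norm (W - \<eta> *\<^sub>R V) \<le> (u + K * u\<^sup>2) * norm (\<eta> *\<^sub>R V)"
    and y': "norm (y' - (y + W)) \<le> (u + K * u\<^sup>2) * (norm y + norm W)"
    and T: "norm (T - \<eta> *\<^sub>R U) \<le> (u + K * u\<^sup>2) * norm (\<eta> *\<^sub>R U)"
    and s': "norm (s' - (s - T)) \<le> (u + K * u\<^sup>2) * (norm s + norm T)"
    and a: "norm y \<le> a" "norm y' \<le> a" and b: "norm s \<le> b" "norm s' \<le> b"
  shows "norm (residual_gap A B y' s') \<le> norm (residual_gap A B y s)
    + ((5 + 2 * real m) * u * (norm A * a) + 5 * u * b
       + (9 * K + 32 * real m + 144) * u\<^sup>2 * (norm A * a + b))"
proof -
  let ?D = "\<eta> *\<^sub>R V"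
  \<comment> \<open>Subtracting \<open>T\<close> is read as adding \<open>- T\<close>, so that the
    update lemma also covers \<open>s'\<close>, with exact update
    \<open>- (\<eta> *\<^sub>R U)\<close>.\<close>
  have T': "norm (- T - - (\<eta> *\<^sub>R U)) \<le> (u + K * u\<^sup>2) * norm (- (\<eta> *\<^sub>R U))"
    using T by (simp add: norm_minus_commute)
  have s'': "norm (s' - (s + - T)) \<le> (u + K * u\<^sup>2) * (norm s + norm (- T))"
    using s' by simp
  note D = rounded_update_le[OF K u W y' a]
  note S = rounded_update_le(2)[OF K u T' s'' b]
  have a0: "0 \<le> norm A * a"
    using order_trans[OF norm_ge_zero a(1)] by simp
  have b0: "0 \<le> b"
    using b(1) norm_ge_zero[of s] by linarith
  have lin: "A ** (\<eta> *\<^sub>R V) = \<eta> *\<^sub>R (A ** V)"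
    by (simp add: matrix_scalar_ac scalar_matrix_assoc)
  have ldiff: "A ** (P - Q) = A ** P - A ** Q" for P Q :: "real^'s^'n"
    using matrix_add_ldistrib[of A "P - Q" Q] by simp
  \<comment> \<open>Each of the three added terms would vanish in exact arithmetic.\<close>
  have "residual_gap A B y' s' = residual_gap A B y s
      + (\<eta> *\<^sub>R (U - A ** V) - A ** (y' - y - ?D) - (s' - s - - (\<eta> *\<^sub>R U)))"
    by (simp add: residual_gap_def ldiff lin matrix_add_ldistrib algebra_simps)
  then have "norm (residual_gap A B y' s') \<le> norm (residual_gap A B y s)
      + (norm (\<eta> *\<^sub>R (U - A ** V)) + norm (A ** (y' - y - ?D)) + norm (s' - s - - (\<eta> *\<^sub>R U)))"
    by (smt (verit) norm_triangle_ineq norm_triangle_ineq4)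
  moreover have "norm (A ** (y' - y - ?D)) \<le> norm A * ((5 * u + (5 * K + 144) * u\<^sup>2) * a)"
    using norm_matrix_mult_le[of A "y' - y - ?D"] mult_left_mono[OF D(2) norm_ge_zero[of A]]
    by linarith
  moreover have "norm (\<eta> *\<^sub>R (U - A ** V)) \<le> (2 * real m * u + (4 * K + 32 * real m) * u\<^sup>2) * (norm A * a)"
  proof -
    \<comment> \<open>The factor \<open>\<bar>\<eta>\<bar>\<close> is merged with
      \<open>norm V\<close> into the norm of the exact update, so no bound on \<open>\<eta>\<close>
      itself is required.\<close>
    have "norm (\<eta> *\<^sub>R (U - A ** V)) \<le> \<bar>\<eta>\<bar> * ((real m * u + K * u\<^sup>2) * norm A * norm V)"
      using mult_left_mono[OF U abs_ge_zero[of \<eta>]] by simp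
    also have "\<dots> = (real m * u + K * u\<^sup>2) * norm A * norm ?D"
      by simp
    also have "\<dots> \<le> (real m * u + K * u\<^sup>2) * norm A * ((2 + 32 * u) * a)"
      using D(1) K u by (intro mult_left_mono) auto
    also have "\<dots> = (real m * u + K * u\<^sup>2) * (2 + 32 * u) * (norm A * a)"
      by (simp add: mult_ac)
    also have "\<dots> \<le> (2 * real m * u + (4 * K + 32 * real m) * u\<^sup>2) * (norm A * a)"
    proof (rule mult_right_mono[OF _ a0])
      \<comment> \<open>The cubic term \<open>32 * K * u^3\<close> is absorbed into
        \<open>2 * K * u\<^sup>2\<close>, whence \<open>4 * K\<close>.\<close>
      have "1 / (16 * (K + 1)) \<le> 1 / 16"
        using K by (simp add: field_simps)
      then have "32 * u \<le> 2"
        using u by linarith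
      then have "(K * u\<^sup>2) * (32 * u) \<le> (K * u\<^sup>2) * 2"
        using K by (intro mult_left_mono) auto
      then show "(real m * u + K * u\<^sup>2) * (2 + 32 * u)
          \<le> 2 * real m * u + (4 * K + 32 * real m) * u\<^sup>2"
        by (simp add: algebra_simps power2_eq_square)
    qed
    finally show ?thesis .
  qed
  \<comment> \<open>The coefficient for \<open>b\<close> is enlarged to the one for
    \<open>norm A * a\<close>, namely the sum of \<open>5 * K + 144\<close> and
    \<open>4 * K + 32 * m\<close>.\<close>
  moreover have "(5 * K + 144) * u\<^sup>2 * b \<le> (9 * K + 32 * real m + 144) * u\<^sup>2 * b"
    using K b0 by (intro mult_right_mono) auto
  ultimately show ?thesis
    using S by (simp add: algebra_simps)
qed

text \<open>The rounding bounds speak only of operands with entries in the floating point set, so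
  membership must be carried along the run. The four claims feed each other and need a joint
  induction; the absence of breakdown keeps the quotient \<open>\<eta>\<close> in the set.\<close>

lemma cirs_run_mem:
  fixes A :: "real^'n^'n" and X :: "nat \<Rightarrow> real^'s^'n"
  assumes rm: "rounding_model fp A m K" and run: "cirs_run fp A primary N X R P V U Y S \<eta>"
    and X0: "X 0 = 0" and R0: "R 0 \<in> matrices_over (fp_set fp)" and "j \<le> N"
  shows "V j \<in> matrices_over (fp_set fp) \<and> Y j \<in> matrices_over (fp_set fp) \<and>
    S j \<in> matrices_over (fp_set fp) \<and> \<eta> j \<in> fp_set fp"
  using \<open>j \<le> N\<close>
proof (induction j)
  case 0
  then show ?case
    using rm run X0 R0
    by (auto simp: cirs_run_def rounding_model_def Let_def matrices_over_def)
next
  case (Suc j)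
  note rm' = rm[unfolded rounding_model_def Let_def]
  have "j < N"
    using Suc.prems by simp
  note st = run[unfolded cirs_run_def, THEN conjunct2, THEN conjunct2, THEN conjunct2,
      THEN conjunct2, rule_format, OF this]
  have V: "V (Suc j) \<in> matrices_over (fp_set fp)"
    using st Suc rm' by auto
  then have U: "U (Suc j) \<in> matrices_over (fp_set fp)"
    using st rm' by auto
  then have "\<eta> (Suc j) \<in> fp_set fp"
    using st Suc rm' by auto
  then show ?case
    using st Suc rm' U V by auto
qed

theorem theorem4p2:
  fixes k m :: nat and K :: real
  assumes "k \<ge> 1" and "K \<ge> 0"
  shows "\<exists>C u\<^sub>0. 0 < u\<^sub>0 \<and>
    (\<forall>(fp :: ('n::finite, 's::finite) fp_arith) u A B primary X R P V U Y S \<eta>.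
       u = fp_u fp \<longrightarrow> 0 < u \<longrightarrow> u \<le> u\<^sub>0 \<longrightarrow>
       A \<in> matrices_over (fp_set fp) \<longrightarrow> invertible A \<longrightarrow> max_row_nonzeros_le A m \<longrightarrow>
       rounding_model fp A m K \<longrightarrow>
       B \<in> matrices_over (fp_set fp) \<longrightarrow> norm B = 1 \<longrightarrow>
       X 0 = 0 \<longrightarrow> R 0 = B \<longrightarrow>
       cirs_run fp A primary k X R P V U Y S \<eta> \<longrightarrow>
       norm (residual_gap A B (Y k) (S k))
         \<le> real k * (5 + 2 * real m) * u * norm A * (MAX j\<in>{0<..k}. norm (Y j))
           + 5 * (real k + 1) * u * (MAX j\<in>{0..k}. norm (S j))
           + C * u^2 * (norm A * (MAX j\<in>{0<..k}. norm (Y j)) + (MAX j\<in>{0..k}. norm (S j))))"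
proof (intro exI conjI allI impI)
  \<comment> \<open>This is the witness for \<open>u\<^sub>0\<close>. The witness for
    \<open>C\<close>, \<open>k * (9 * K + 32 * m + 144)\<close>, is fixed by the final bound and
    depends on \<open>k\<close>, \<open>m\<close> and \<open>K\<close> only.\<close>
  show "0 < 1 / (16 * (K + 1))"
    using \<open>K \<ge> 0\<close> by simp
  fix fp :: "('n, 's) fp_arith" and u A and B :: "real^'s^'n" and primary X R P V U Y S \<eta>
  assume fpu: "u = fp_u fp" and u: "0 < u" "u \<le> 1 / (16 * (K + 1))"
    and rm: "rounding_model fp A m K" and B: "B \<in> matrices_over (fp_set fp)"
    and X0: "X 0 = 0" and R0: "R 0 = B"
    and run: "cirs_run fp A primary k X R P V U Y S \<eta>"
  define a where "a = (MAX j\<in>{0<..k}. norm (Y j))"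
  define b where "b = (MAX j\<in>{0..k}. norm (S j))"
  \<comment> \<open>A bound on the growth in one step, uniform in the step since \<open>a\<close>
    and \<open>b\<close> dominate all iterates.\<close>
  define c where "c = (5 + 2 * real m) * u * (norm A * a) + 5 * u * b
       + (9 * K + 32 * real m + 144) * u\<^sup>2 * (norm A * a + b)"
  have Y0: "Y 0 = 0" and S0: "S 0 = B"
    using run X0 R0 by (auto simp: cirs_run_def)
  have aj: "norm (Y j) \<le> a" if "0 < j" "j \<le> k" for j
    unfolding a_def using that by (intro Max_ge) auto
  \<comment> \<open>Index 0 lies outside the maximum, but \<open>Y 0 = 0\<close> and
    \<open>a\<close> is nonnegative because \<open>k \<ge> 1\<close>.\<close>
  have Ya: "norm (Y j) \<le> a" if "j \<le> k" for j
    using aj[of j] aj[of 1] that Y0 \<open>k \<ge> 1\<close> order_trans[OF norm_ge_zero]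
    by (cases "j = 0") auto
  have Sb: "norm (S j) \<le> b" if "j \<le> k" for j
    unfolding b_def using that by (intro Max_ge) auto
  \<comment> \<open>The gap starts at zero, since \<open>Y 0 = 0\<close> and \<open>S 0 = B\<close>,
    and grows by at most \<open>c\<close> per step.\<close>
  have gap: "norm (residual_gap A B (Y j) (S j)) \<le> real j * c" if "j \<le> k" for j
    using that
  proof (induction j)
    case 0
    have "A ** (0 :: real^'s^'n) = 0"
      by (simp add: vec_eq_iff matrix_matrix_mult_def)
    then show ?case
      by (simp add: residual_gap_def Y0 S0)
  next
    case (Suc j)
    note rm' = rm[unfolded rounding_model_def Let_def, folded fpu]
    have "j < k" and jk: "j \<le> k"
      using Suc.prems by simp_all
    note st = run[unfolded cirs_run_def, THEN conjunct2, THEN conjunct2, THEN conjunct2,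
        THEN conjunct2, rule_format, OF \<open>j < k\<close>]
    note mem = cirs_run_mem[OF rm run X0, unfolded R0, OF B]
    note m0 = mem[OF jk] and m1 = mem[OF Suc.prems]
    have U: "U (Suc j) \<in> matrices_over (fp_set fp)"
      using st rm' m1 by auto
    let ?W = "fp_scale fp (\<eta> (Suc j)) (V (Suc j))" and ?T = "fp_scale fp (\<eta> (Suc j)) (U (Suc j))"
    have W: "?W \<in> matrices_over (fp_set fp)" and T: "?T \<in> matrices_over (fp_set fp)"
      using rm' m1 U by auto
    have "norm (residual_gap A B (Y (Suc j)) (S (Suc j)))
        \<le> norm (residual_gap A B (Y j) (S j)) + c"
      unfolding c_def
    proof (rule residual_gap_step[where W = ?W and T = ?T and V = "V (Suc j)" and U = "U (Suc j)"
          and \<eta> = "\<eta> (Suc j)", OF \<open>K \<ge> 0\<close> u])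
      show "norm (U (Suc j) - A ** V (Suc j))
          \<le> (real m * u + K * u\<^sup>2) * norm A * norm (V (Suc j))"
        using st rm' m1 by auto
      show "norm (?W - \<eta> (Suc j) *\<^sub>R V (Suc j)) \<le> (u + K * u\<^sup>2) * norm (\<eta> (Suc j) *\<^sub>R V (Suc j))"
        using rm' m1 by blast
      show "norm (?T - \<eta> (Suc j) *\<^sub>R U (Suc j)) \<le> (u + K * u\<^sup>2) * norm (\<eta> (Suc j) *\<^sub>R U (Suc j))"
        using rm' m1 U by blast
      have "Y (Suc j) = fp_add fp (Y j) ?W"
        using st by blast
      then show "norm (Y (Suc j) - (Y j + ?W)) \<le> (u + K * u\<^sup>2) * (norm (Y j) + norm ?W)"
        using rm' m0 W by simp
      have "S (Suc j) = fp_sub fp (S j) ?T"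
        using st by blast
      then show "norm (S (Suc j) - (S j - ?T)) \<le> (u + K * u\<^sup>2) * (norm (S j) + norm ?T)"
        using rm' m0 T by simp
    qed (use Ya Sb jk Suc.prems in auto)
    then show ?case
      using Suc.IH[OF jk] by (simp add: algebra_simps)
  qed
  \<comment> \<open>The induction yields the factor \<open>5 * k\<close>; adding
    \<open>5 * u * b\<close> gives the stated \<open>5 * (k + 1)\<close>.\<close>
  have "0 \<le> u * b"
    using u Sb[of 0] norm_ge_zero[of "S 0"] by (intro mult_nonneg_nonneg) linarith+
  then have "real k * c \<le> real k * (5 + 2 * real m) * u * norm A * a + 5 * (real k + 1) * u * b
      + real k * (9 * K + 32 * real m + 144) * u\<^sup>2 * (norm A * a + b)"
    by (simp add: c_def algebra_simps)
  then show "norm (residual_gap A B (Y k) (S k))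
      \<le> real k * (5 + 2 * real m) * u * norm A * (MAX j\<in>{0<..k}. norm (Y j))
        + 5 * (real k + 1) * u * (MAX j\<in>{0..k}. norm (S j))
        + real k * (9 * K + 32 * real m + 144) * u^2
          * (norm A * (MAX j\<in>{0<..k}. norm (Y j)) + (MAX j\<in>{0..k}. norm (S j)))"
    using gap[of k] unfolding a_def b_def by linarith
qed

end
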